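(* Let $X$ be a separable Banach space, and let $\{f_k\}_{k=1}^\infty\subset X$ and $\{g_k\}_{k=1}^\infty\subset X^*$ be such that $(\{f_k\}_{k=1}^\infty,\{g_k\}_{k=1}^\infty)$ is an atomic decomposition of $X$ with respect to $\ell^p$ for some $p\in[1,\infty)$, with bounds $A,B$. Take $\epsilon_j=\epsilon2^{-j}$, $j\in\mathbb N$, for some $0<\epsilon<B^{-1}$. Let $T:X\to X$ be a bounded linear operator, $\varphi\in X$, and $\alpha(k)$, $k\in\mathbb N$, nonnegative integers such that $$\|f_k-T^{\alpha(k)}\varphi\|\le\sum_{j=k+1}^\infty\epsilon_j,\qquad\forall k\in\mathbb N.$$ Then there exists a family $\{g_k'\}_{k=1}^\infty\subset X^*$ such that $(\{T^{\alpha(k)}\varphi\}_{k=1}^\infty,\{g_k'\}_{k=1}^\infty)$ is an atomic decomposition of $X$ with respect to $\ell^p$, with bounds $A(1+\epsilon B)^{-1}$ and $B(1-\epsilon B)^{-1}$. Moreover, $\{T^{\alpha(k)}\varphi\}_{k=1}^\infty$ is a basis for $X$ if and only if $\{f_k\}_{k=1}^\infty$ is a basis for $X$.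
   Context: Given a Banach space $X$, a Banach space $X_d$ of scalar-valued sequences indexed by $\mathbb N$, and sequences $\{e_k\}_{k=1}^\infty\subset X$ and $\{e_k^*\}_{k=1}^\infty\subset X^*$, the pair $(\{e_k\}_{k=1}^\infty,\{e_k^*\}_{k=1}^\infty)$ is called an atomic decomposition of $X$ with respect to $X_d$, with bounds $A,B>0$, if (i) $\{\langle x,e_k^*\rangle\}_{k=1}^\infty\in X_d$ for all $x\in X$; (ii) $A\|x\|\le\|\{\langle x,e_k^*\rangle\}_{k=1}^\infty\|_{X_d}\le B\|x\|$ for all $x\in X$; (iii) $x=\sum_{k=1}^\infty\langle x,e_k^*\rangle e_k$ for all $x\in X$. Here $\langle x,e_k^*\rangle$ is the value of the functional $e_k^*$ at $x$. No biorthogonality between $\{e_k\}$ and $\{e_k^*\}$ is assumed. A basis of $X$ is a Schauder basis: every $x\in X$ has a unique representation $x=\sum_{k=1}^\infty c_ke_k$ with scalars $c_k\in\mathbb C$. *)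

theory Defs
  imports "HOL-Analysis.Analysis"
begin

(* The type class banach provides real Banach spaces only; the scalar field here is the
   complex numbers. *)

class scaleC = scaleR +
  fixes scaleC :: "complex \<Rightarrow> 'a \<Rightarrow> 'a"  (infixr "*\<^sub>C" 75)
  assumes scaleR_scaleC: "scaleR r x = scaleC (complex_of_real r) x"

class complex_banach = banach + scaleC +
  assumes scaleC_add_right: "a *\<^sub>C (x + y) = a *\<^sub>C x + a *\<^sub>C y"
    and scaleC_add_left: "(a + b) *\<^sub>C x = a *\<^sub>C x + b *\<^sub>C x"
    and scaleC_scaleC: "a *\<^sub>C (b *\<^sub>C x) = (a * b) *\<^sub>C x"
    and norm_scaleC: "norm (a *\<^sub>C x) = cmod a * norm x"

instantiation complex :: complex_banach
begin

definition scaleC_complex :: "complex \<Rightarrow> complex \<Rightarrow> complex"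
  where "scaleC_complex a x = a * x"

instance
  by standard (simp_all add: scaleC_complex_def scaleR_conv_of_real algebra_simps norm_mult)

end

definition bounded_clinear :: "('a::complex_banach \<Rightarrow> 'b::complex_banach) \<Rightarrow> bool"
  where "bounded_clinear T \<longleftrightarrow> bounded_linear T \<and> (\<forall>c x. T (c *\<^sub>C x) = c *\<^sub>C T x)"

definition dual_space :: "('a::complex_banach \<Rightarrow> complex) set"
  where "dual_space = {g. bounded_clinear g}"

(* Sequences indexed by the positive integers are represented by functions on nat with the index
   shifted by one: s n stands for the term with index n + 1. *)

definition schauder_basis :: "(nat \<Rightarrow> 'a::complex_banach) \<Rightarrow> bool"
  where "schauder_basis e \<longleftrightarrow> (\<forall>x. \<exists>!c :: nat \<Rightarrow> complex. (\<lambda>k. c k *\<^sub>C e k) sums x)"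

definition lp_space :: "real \<Rightarrow> (nat \<Rightarrow> complex) set"
  where "lp_space p = {c. summable (\<lambda>k. cmod (c k) powr p)}"

definition lp_norm :: "real \<Rightarrow> (nat \<Rightarrow> complex) \<Rightarrow> real"
  where "lp_norm p c = (\<Sum>k. cmod (c k) powr p) powr (1 / p)"

(* The Banach space of sequences is given by its set of elements Xd and its norm Nd. *)

definition atomic_decomposition ::
    "(nat \<Rightarrow> complex) set \<Rightarrow> ((nat \<Rightarrow> complex) \<Rightarrow> real) \<Rightarrow> real \<Rightarrow> real \<Rightarrow>
     (nat \<Rightarrow> 'a::complex_banach) \<Rightarrow> (nat \<Rightarrow> 'a \<Rightarrow> complex) \<Rightarrow> bool"
  where "atomic_decomposition Xd Nd A B e e' \<longleftrightarrow>
    0 < A \<and> 0 < B \<and>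
    (\<forall>k. e' k \<in> dual_space) \<and>
    (\<forall>x. (\<lambda>k. e' k x) \<in> Xd) \<and>
    (\<forall>x. A * norm x \<le> Nd (\<lambda>k. e' k x) \<and> Nd (\<lambda>k. e' k x) \<le> B * norm x) \<and>
    (\<forall>x. (\<lambda>k. e' k x *\<^sub>C e k) sums x)"

end

theory Submission
  imports Defs
begin

text \<open>Put \<open>h\<^sub>k = T\<^bsup>\<alpha> k\<^esup> \<phi>\<close> and \<open>U x = (\<Sum>k. g\<^sub>k(x) h\<^sub>k)\<close>. Every coefficient is dominated by the
  \<open>\<ell>\<^sup>p\<close> norm of the coefficient sequence, so the errors \<open>\<parallel>f\<^sub>k - h\<^sub>k\<parallel>\<close>, whose sum is at most \<open>\<epsilon>\<close>, give
  \<open>\<parallel>x - U x\<parallel> \<le> \<epsilon> B \<parallel>x\<parallel>\<close>. As \<open>\<epsilon> B < 1\<close>, \<open>U\<close> is an isomorphism, and the functionals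
  \<open>g\<^sub>k \<circ> U\<^sup>-\<^sup>1\<close> complete \<open>h\<close> to an atomic decomposition. If \<open>f\<close> is a basis, then \<open>g\<close> is biorthogonal to
  \<open>f\<close> and \<open>U\<close> maps \<open>f\<^sub>k\<close> to \<open>h\<^sub>k\<close>; if \<open>h\<close> is a basis, the same argument applies to \<open>U\<^sup>-\<^sup>1\<close>.\<close>

lemma scaleC_zero_left [simp]: "0 *\<^sub>C (x::'a::complex_banach) = 0"
  using norm_scaleC[of 0 x] by simp

lemma scaleC_one [simp]: "1 *\<^sub>C (x::'a::complex_banach) = x"
  using scaleR_scaleC[of 1 x] by simp

text \<open>Makes the \<open>bounded_linear\<close> facts on differences and series available for
  complex scaling.\<close>

lemma bounded_clinear_scaleC: "bounded_clinear (\<lambda>x::'a::complex_banach. c *\<^sub>C x)"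
proof -
  have "bounded_linear (\<lambda>x::'a. c *\<^sub>C x)"
    by (rule bounded_linear_intro[where K = "cmod c"])
      (simp_all add: scaleC_add_right scaleR_scaleC scaleC_scaleC norm_scaleC mult.commute)
  then show ?thesis
    by (simp add: bounded_clinear_def scaleC_scaleC mult.commute)
qed

lemma scaleC_diff_right: "c *\<^sub>C (x - y) = c *\<^sub>C x - c *\<^sub>C (y::'a::complex_banach)"
  using bounded_clinear_scaleC[of c, where 'a = 'a]
  by (intro linear_diff bounded_linear.linear) (simp add: bounded_clinear_def)

lemma sums_scaleC: "f sums x \<Longrightarrow> (\<lambda>k. c *\<^sub>C f k) sums (c *\<^sub>C (x::'a::complex_banach))"
  using bounded_clinear_scaleC[of c] by (auto simp: bounded_clinear_def intro: bounded_linear.sums)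

lemma bounded_clinear_compose:
  "bounded_clinear S \<Longrightarrow> bounded_clinear R \<Longrightarrow> bounded_clinear (\<lambda>x. S (R x))"
  by (auto simp: bounded_clinear_def intro: bounded_linear_compose)

text \<open>One nonnegative term is at most the whole series, and taking the power
  \<open>1 / p\<close> is monotone. This gives a bound on the coefficient functionals that is
  uniform in the index.\<close>

lemma norm_coeff_le_lp_norm:
  assumes "1 \<le> p" "c \<in> lp_space p"
  shows "cmod (c k) \<le> lp_norm p c"
proof -
  have "cmod (c k) powr p \<le> (\<Sum>k. cmod (c k) powr p)"
    using sum_le_suminf[of "\<lambda>k. cmod (c k) powr p" "{k}"] assms(2) by (simp add: lp_space_def)
  then have "(cmod (c k) powr p) powr (1 / p) \<le> lp_norm p c"
    unfolding lp_norm_def using assms(1) by (intro powr_mono2) auto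
  then show ?thesis
    using assms(1) by (simp add: powr_powr)
qed

text \<open>Comparison with the series of \<open>M * norm x * \<delta> k\<close> yields absolute
  convergence and the norm bound at once; linearity passes from the \<open>g k\<close> to
  \<open>D\<close> by uniqueness of limits.\<close>

lemma perturbation_operator:
  fixes g :: "nat \<Rightarrow> 'a::complex_banach \<Rightarrow> complex" and d :: "nat \<Rightarrow> 'b::complex_banach"
  assumes g: "\<And>k. bounded_clinear (g k)"
    and g_le: "\<And>k x. cmod (g k x) \<le> M * norm x"
    and d_le: "\<And>k. norm (d k) \<le> \<delta> k" and \<delta>: "\<delta> sums s"
  obtains D where "bounded_clinear D" "\<And>x. (\<lambda>k. g k x *\<^sub>C d k) sums D x"
    "\<And>x. norm (D x) \<le> M * s * norm x"
proof -
  define D where "D x = (\<Sum>k. g k x *\<^sub>C d k)" for x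
  have term_le: "norm (g k x *\<^sub>C d k) \<le> M * norm x * \<delta> k" for k x
    \<comment> \<open>The nonnegativity of \<open>M * norm x\<close> comes from \<open>g_le\<close>,
      whose left side is a norm.\<close>
    using mult_mono[OF g_le[of k x] d_le[of k] order_trans[OF norm_ge_zero g_le]]
    by (simp add: norm_scaleC)
  have bound_sums: "(\<lambda>k. M * norm x * \<delta> k) sums (M * norm x * s)" for x
    by (intro sums_mult \<delta>)
  have D_sums: "(\<lambda>k. g k x *\<^sub>C d k) sums D x" for x
    unfolding D_def
    by (intro summable_sums summable_comparison_test[OF _ sums_summable[OF bound_sums[of x]]])
      (use term_le in auto)
  have D_le: "norm (D x) \<le> M * s * norm x" for x
  proof -
    have "norm (D x) \<le> (\<Sum>k. M * norm x * \<delta> k)"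
      unfolding D_def
      by (intro norm_suminf_le term_le sums_summable[OF bound_sums])
    then show ?thesis
      using sums_unique[OF bound_sums[of x]] by (simp add: mult_ac)
  qed
  have D_add: "D (x + y) = D x + D y" for x y
  proof -
    have "g k (x + y) = g k x + g k y" for k
      using g[of k] by (simp add: bounded_clinear_def linear_add bounded_linear.linear)
    then show ?thesis
      using sums_unique2[OF D_sums[of "x + y"]] sums_add[OF D_sums[of x] D_sums[of y]]
      by (simp add: scaleC_add_left)
  qed
  have D_scale: "D (c *\<^sub>C x) = c *\<^sub>C D x" for c x
  proof -
    have "g k (c *\<^sub>C x) = c * g k x" for k
      using g[of k] by (simp add: bounded_clinear_def scaleC_complex_def)
    then show ?thesis
      using sums_unique2[OF D_sums[of "c *\<^sub>C x"]] sums_scaleC[OF D_sums[of x], of c]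
      by (simp add: scaleC_scaleC)
  qed
  have "bounded_linear D"
    by (rule bounded_linear_intro[where K = "M * s"])
      (use D_add D_scale D_le in \<open>simp_all add: scaleR_scaleC mult.commute\<close>)
  then show ?thesis
    using that[of D] D_scale D_sums D_le by (simp add: bounded_clinear_def)
qed

text \<open>Solving \<open>x - D x = y\<close> means finding a fixed point of the contraction
  sending \<open>x\<close> to \<open>y + D x\<close>, so Banach's fixed point theorem replaces the
  Neumann series.\<close>

lemma identity_minus_contraction_inverse:
  fixes D :: "'a::complex_banach \<Rightarrow> 'a"
  assumes D: "bounded_clinear D" and D_le: "\<And>x. norm (D x) \<le> q * norm x"
    and q: "0 \<le> q" "q < 1"
  obtains V where "bounded_clinear V" "\<And>x. V (x - D x) = x" "\<And>y. V y - D (V y) = y"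
proof -
  have lin: "linear D" and D_scale: "\<And>c x. D (c *\<^sub>C x) = c *\<^sub>C D x"
    using D by (auto simp: bounded_clinear_def bounded_linear.linear)
  have "\<exists>!x. x - D x = y" for y
  proof -
    have "\<exists>!x. x \<in> UNIV \<and> y + D x = x"
      by (rule Banach_fix[OF complete_UNIV _ q])
        (use D_le in \<open>auto simp: dist_norm linear_diff[OF lin, symmetric]\<close>)
    then show ?thesis
      by (simp add: algebra_simps eq_commute)
  qed
  \<comment> \<open>\<open>V_eq\<close> records uniqueness of the solution: linearity of
    \<open>V\<close> then only requires checking that the candidate solves the equation.\<close>
  then obtain V where V: "\<And>y. V y - D (V y) = y" and V_eq: "\<And>x y. x - D x = y \<Longrightarrow> V y = x"
    by metis
  have V_add: "V (x + y) = V x + V y" for x y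
    using V[of x] V[of y] by (intro V_eq) (simp add: linear_add[OF lin] algebra_simps)
  have V_scale: "V (c *\<^sub>C x) = c *\<^sub>C V x" for c x
    using V[of x] by (intro V_eq) (simp add: D_scale scaleC_diff_right[symmetric])
  have V_le: "norm (V y) \<le> norm y * inverse (1 - q)" for y
  proof -
    have "norm (V y) - norm (D (V y)) \<le> norm y"
      using norm_triangle_ineq2[of "V y" "D (V y)"] V[of y] by simp
    then have "norm (V y) * (1 - q) \<le> norm y"
      using D_le[of "V y"] by (simp add: algebra_simps)
    then show ?thesis
      using q by (simp add: field_simps)
  qed
  have "bounded_linear V"
    by (rule bounded_linear_intro[where K = "inverse (1 - q)"])
      (use V_add V_scale V_le in \<open>simp_all add: scaleR_scaleC\<close>)
  then show ?thesis
    using that[of V] V V_eq V_scale by (simp add: bounded_clinear_def)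
qed

text \<open>\<open>U\<close> and \<open>V\<close> carry convergent expansions into each other with
  the same coefficients, so existence and uniqueness both transfer.\<close>

lemma schauder_basis_image:
  assumes e: "schauder_basis e"
    and U: "bounded_clinear U" and V: "bounded_clinear V"
    and VU: "\<And>x. V (U x) = x" and UV: "\<And>y. U (V y) = y"
  shows "schauder_basis (\<lambda>k. U (e k))"
proof -
  have "(\<lambda>k. c k *\<^sub>C U (e k)) sums y \<longleftrightarrow> (\<lambda>k. c k *\<^sub>C e k) sums V y" for c y
    using U V bounded_linear.sums[of U "\<lambda>k. c k *\<^sub>C e k" "V y"]
      bounded_linear.sums[of V "\<lambda>k. c k *\<^sub>C U (e k)" y]
    by (auto simp: bounded_clinear_def VU UV)
  then show ?thesis
    using e by (simp add: schauder_basis_def)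
qed

text \<open>Biorthogonality is forced by uniqueness: \<open>e j\<close> also has the trivial
  expansion with the single coefficient 1.\<close>

lemma schauder_basis_coefficients:
  assumes e: "schauder_basis e" and \<psi>: "\<And>x. (\<lambda>k. \<psi> k x *\<^sub>C e k) sums x"
  shows "\<psi> k (e j) = (if k = j then 1 else 0)"
proof -
  have "(\<lambda>k. (if k = j then 1 else 0) *\<^sub>C e k) sums e j"
    using sums_If_finite[of "\<lambda>k. k = j" e] by (simp add: if_distrib[of "\<lambda>c. c *\<^sub>C _"] cong: if_cong)
  moreover have "\<exists>!c. (\<lambda>k. c k *\<^sub>C e k) sums e j"
    using e by (simp add: schauder_basis_def)
  ultimately have "(\<lambda>k. \<psi> k (e j)) = (\<lambda>k. if k = j then 1 else 0)"
    by (metis \<psi>)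
  then show ?thesis
    by (rule fun_cong)
qed

text \<open>By biorthogonality the series for \<open>U (e j)\<close> collapses to
  \<open>h j\<close>, so \<open>h\<close> is the image of a basis under an isomorphism.\<close>

lemma schauder_basis_transfer:
  assumes e: "schauder_basis e" and \<psi>: "\<And>x. (\<lambda>k. \<psi> k x *\<^sub>C e k) sums x"
    and U: "bounded_clinear U" and V: "bounded_clinear V"
    and VU: "\<And>x. V (U x) = x" and UV: "\<And>y. U (V y) = y"
    and U_sums: "\<And>x. (\<lambda>k. \<psi> k x *\<^sub>C h k) sums U x"
  shows "schauder_basis h"
proof -
  have "U (e j) = h j" for j
  proof -
    have "(\<lambda>k. \<psi> k (e j) *\<^sub>C h k) sums h j"
      using sums_If_finite[of "\<lambda>k. k = j" h]
      by (simp add: schauder_basis_coefficients[OF e \<psi>] if_distrib[of "\<lambda>c. c *\<^sub>C _"] cong: if_cong)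
    then show ?thesis
      using U_sums sums_unique2 by blast
  qed
  then show ?thesis
    using schauder_basis_image[OF e U V VU UV] by simp
qed

text \<open>With indices shifted by one, position \<open>k\<close> stands for index
  \<open>k + 1\<close>, so the tail starts at the power \<open>k + 2\<close> of 1/2 and sums to the
  power \<open>k + 1\<close>.\<close>

lemma geometric_tail_sum:
  fixes \<epsilon> :: real
  shows "(\<Sum>i. \<epsilon> / 2 ^ (k + 1 + i + 1)) = \<epsilon> * (1 / 2) ^ Suc k"
proof -
  have "(\<lambda>i. \<epsilon> * (1 / 2) ^ Suc k * (1 / 2) ^ Suc i) sums (\<epsilon> * (1 / 2) ^ Suc k * 1)"
    by (rule sums_mult[OF power_half_series])
  moreover have "\<epsilon> * (1 / 2) ^ Suc k * (1 / 2) ^ Suc i = \<epsilon> / 2 ^ (k + 1 + i + 1)" for i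
    by (simp add: power_add power_divide)
  ultimately have "(\<lambda>i. \<epsilon> / 2 ^ (k + 1 + i + 1)) sums (\<epsilon> * (1 / 2) ^ Suc k)"
    by (simp only: mult_1_right)
  then show ?thesis
    by (rule sums_unique[symmetric])
qed

theorem corollary2p10:
  fixes f :: "nat \<Rightarrow> 'a::complex_banach"
    and g :: "nat \<Rightarrow> 'a \<Rightarrow> complex"
    and T :: "'a \<Rightarrow> 'a"
    and \<phi> :: 'a
    and \<alpha> :: "nat \<Rightarrow> nat"
    and p A B \<epsilon> :: real
    and eps :: "nat \<Rightarrow> real"
  assumes "separable_space (euclidean :: 'a topology)"
    and "1 \<le> p"
    and "atomic_decomposition (lp_space p) (lp_norm p) A B f g"
    and "0 < \<epsilon>" and "\<epsilon> < inverse B"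
    and "\<And>j. eps j = \<epsilon> / 2 ^ (j + 1)"
    and "bounded_clinear T"
    and "\<And>k. norm (f k - (T ^^ \<alpha> k) \<phi>) \<le> (\<Sum>i. eps (k + 1 + i))"
  shows "(\<exists>g'. atomic_decomposition (lp_space p) (lp_norm p)
                 (A * inverse (1 + \<epsilon> * B)) (B * inverse (1 - \<epsilon> * B))
                 (\<lambda>k. (T ^^ \<alpha> k) \<phi>) g') \<and>
         (schauder_basis (\<lambda>k. (T ^^ \<alpha> k) \<phi>) \<longleftrightarrow> schauder_basis f)"
proof -
  define h where "h k = (T ^^ \<alpha> k) \<phi>" for k
  have pos: "0 < A" "0 < B" and g: "\<And>k. bounded_clinear (g k)"
    and g_lp: "\<And>x. (\<lambda>k. g k x) \<in> lp_space p"
    and lower: "\<And>x. A * norm x \<le> lp_norm p (\<lambda>k. g k x)"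
    and upper: "\<And>x. lp_norm p (\<lambda>k. g k x) \<le> B * norm x"
    and expand: "\<And>x. (\<lambda>k. g k x *\<^sub>C f k) sums x"
    using assms(3) unfolding atomic_decomposition_def dual_space_def by blast+
  have q: "0 \<le> B * \<epsilon>" "B * \<epsilon> < 1"
    using assms(4,5) pos by (auto simp: field_simps)
  have g_le: "cmod (g k x) \<le> B * norm x" for k x
    using norm_coeff_le_lp_norm[OF assms(2) g_lp] upper order_trans by blast
  have d_le: "norm (f k - h k) \<le> \<epsilon> * (1 / 2) ^ Suc k" for k
    using assms(8)[of k] by (simp only: assms(6) h_def geometric_tail_sum)
  \<comment> \<open>The tails are again geometric, so the total error is at most
    \<open>\<epsilon>\<close>; this yields the constant \<open>B * \<epsilon>\<close> for
    \<open>D\<close>.\<close>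
  have \<epsilon>_sums: "(\<lambda>k. \<epsilon> * (1 / 2) ^ Suc k) sums \<epsilon>"
    using sums_mult[OF power_half_series, of \<epsilon>] by simp
  obtain D where D: "bounded_clinear D"
    and D_sums: "\<And>x. (\<lambda>k. g k x *\<^sub>C (f k - h k)) sums D x"
    and D_le: "\<And>x. norm (D x) \<le> B * \<epsilon> * norm x"
    using perturbation_operator[of g B "\<lambda>k. f k - h k", OF g g_le d_le \<epsilon>_sums] by blast
  obtain V where V: "bounded_clinear V"
    and VU: "\<And>x. V (x - D x) = x" and UV: "\<And>y. V y - D (V y) = y"
    using identity_minus_contraction_inverse[OF D D_le q] by blast
  have U: "bounded_clinear (\<lambda>x. x - D x)"
    using D by (auto simp: bounded_clinear_def scaleC_diff_right intro: bounded_linear_sub bounded_linear_ident)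
  have U_sums: "(\<lambda>k. g k x *\<^sub>C h k) sums (x - D x)" for x
    using sums_diff[OF expand[of x] D_sums[of x]] by (simp add: scaleC_diff_right)
  have V_sums: "(\<lambda>k. g k (V y) *\<^sub>C h k) sums y" for y
    using U_sums[of "V y"] by (simp add: UV)
  \<comment> \<open>Both bounds on \<open>V\<close> come from \<open>y = V y - D (V y)\<close> and
    the triangle inequality; they supply the factors in the new frame bounds.\<close>
  have V_ge: "inverse (1 + \<epsilon> * B) * norm y \<le> norm (V y)" for y
  proof -
    have "norm y \<le> norm (V y) + norm (D (V y))"
      using norm_triangle_ineq4[of "V y" "D (V y)"] by (simp add: UV)
    also have "\<dots> \<le> (1 + \<epsilon> * B) * norm (V y)"
      using D_le[of "V y"] by (simp add: algebra_simps)
    finally show ?thesis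
      using q by (simp add: field_simps)
  qed
  have V_le: "norm (V y) \<le> inverse (1 - \<epsilon> * B) * norm y" for y
  proof -
    have "norm (V y) - norm (D (V y)) \<le> norm y"
      using norm_triangle_ineq2[of "V y" "D (V y)"] by (simp add: UV)
    then have "(1 - \<epsilon> * B) * norm (V y) \<le> norm y"
      using D_le[of "V y"] by (simp add: algebra_simps)
    then show ?thesis
      using q by (simp add: field_simps)
  qed
  have "A * inverse (1 + \<epsilon> * B) * norm y \<le> lp_norm p (\<lambda>k. g k (V y))" for y
    using order_trans[OF mult_left_mono[OF V_ge, of A y] lower[of "V y"]] pos by (simp add: mult.assoc)
  moreover have "lp_norm p (\<lambda>k. g k (V y)) \<le> B * inverse (1 - \<epsilon> * B) * norm y" for y
    using order_trans[OF upper[of "V y"] mult_left_mono[OF V_le, of B y]] pos by (simp add: mult.assoc)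
  moreover have "0 < A * inverse (1 + \<epsilon> * B)" "0 < B * inverse (1 - \<epsilon> * B)"
    using pos q by (simp_all add: mult.commute add_pos_nonneg)
  ultimately have "atomic_decomposition (lp_space p) (lp_norm p)
      (A * inverse (1 + \<epsilon> * B)) (B * inverse (1 - \<epsilon> * B)) h (\<lambda>k y. g k (V y))"
    unfolding atomic_decomposition_def dual_space_def
    using g_lp V_sums bounded_clinear_compose[OF g V] by simp
  moreover have "schauder_basis h" if "schauder_basis f"
    using schauder_basis_transfer[OF that expand U V VU UV U_sums] .
  moreover have "schauder_basis f" if "schauder_basis h"
    \<comment> \<open>Roles are exchanged: the coefficients are now \<open>g k (V y)\<close>, and
      \<open>expand\<close> at \<open>V y\<close> says that they sum against \<open>f\<close> to
      \<open>V y\<close>.\<close>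
    using schauder_basis_transfer[OF that V_sums V U UV VU expand] .
  ultimately show ?thesis
    unfolding h_def[symmetric] by blast
qed

end
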